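(* Let $n$ be a positive integer and let $l\ge 0$ be the integer with $2^l\leq n<2^{l+1}$. Let $p_{\leq n}(n)$ denote the number of partitions of $n$ whose product of summands is at most $n$. Then \[ p_{\leq n}(n)=n+\sum_{k=2}^l\sum_{i_1=2}^{\left\lfloor\sqrt[k]{n}\right\rfloor}\sum_{i_2=i_1}^{\left\lfloor\sqrt[k-1]{\frac{n}{i_1}}\right\rfloor}\sum_{i_3=i_2}^{\left\lfloor\sqrt[k-2]{\frac{n}{i_1i_2}}\right\rfloor}\cdots\sum_{i_{k-1}=i_{k-2}}^{\left\lfloor\sqrt{\frac{n}{i_1i_2\cdots i_{k-2}}}\right\rfloor}\left(\left\lfloor\frac{n}{i_1i_2\cdots i_{k-1}}\right\rfloor-i_{k-1}+1\right), \] where for each $k$ the sum is a $(k-1)$-fold nested sum over integers $2\le i_1\le i_2\le\cdots\le i_{k-1}$ with the indicated upper limits (for $k=2$ it is the single sum $\sum_{i_1=2}^{\lfloor\sqrt{n}\rfloor}(\lfloor n/i_1\rfloor-i_1+1)$), and an empty sum is $0$.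
   Context: A partition of a non-negative integer $n$ is a representation of $n$ as a sum of unordered positive integers (its parts or summands). The product of the summands of a partition is the product of all its parts counted with multiplicity. $\lfloor x\rfloor$ denotes the greatest integer $\le x$. *)

theory Defs
  imports Complex_Main "HOL-Library.Multiset"
begin

definition partitions :: "nat \<Rightarrow> nat multiset set" where
  "partitions n = {M. (\<forall>x \<in># M. 0 < x) \<and> \<Sum>\<^sub># M = n}"

definition num_partitions_prod_le :: "nat \<Rightarrow> nat \<Rightarrow> nat" where
  "num_partitions_prod_le m n = card {M \<in> partitions n. \<Prod>\<^sub># M \<le> m}"

(* nested_sum n m P i is what remains of the nested sum once some of its indices are chosen:
   m is the number of summation signs still to come, P the product of the chosen indices and
   i the last of them (i = 2 if none is chosen yet, the lower limit of the first index).  With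
   m + 1 signs to come, the next upper limit is the floor of the (m + 2)-th root of n / P.  The
   complete (k - 1)-fold sum is therefore nested_sum n (k - 1) 1 2. *)
fun nested_sum :: "nat \<Rightarrow> nat \<Rightarrow> int \<Rightarrow> int \<Rightarrow> int" where
  "nested_sum n 0 P i = \<lfloor>real n / real_of_int P\<rfloor> - i + 1"
| "nested_sum n (Suc m) P i =
     (\<Sum>j = i..\<lfloor>root (m + 2) (real n / real_of_int P)\<rfloor>. nested_sum n m (P * j) j)"

end

theory Submission
  imports Defs
begin

text \<open>
  Deleting the parts equal to 1 turns a partition of \<open>n\<close> with product at most \<open>n\<close> into a
  multiset of integers \<open>\<ge> 2\<close> with product at most \<open>n\<close>. Nothing is lost: since sum \<open>\<le>\<close> product
  for such multisets, each of them can be filled up with ones to a partition of \<open>n\<close>.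
  The empty multiset and the singletons account for \<open>n\<close>; those of size \<open>k \<ge> 2\<close> are counted by
  repeatedly splitting off the least element, and \<open>k \<le> l\<close> because the product is at least \<open>2^k\<close>.
\<close>

text \<open>The parameters mirror those of \<open>nested_sum\<close>: \<open>P\<close> is the
  product of the elements already split off, \<open>i\<close> the last of them, \<open>k\<close> the
  number still to be chosen.\<close>

definition bounded_prod_msets :: "nat \<Rightarrow> nat \<Rightarrow> nat \<Rightarrow> nat \<Rightarrow> nat multiset set" where
  "bounded_prod_msets n k P i = {M. size M = k \<and> (\<forall>x\<in>#M. i \<le> x) \<and> P * \<Prod>\<^sub># M \<le> n}"

section \<open>Lower bounds for products\<close>

lemma power_size_le_prod_mset:
  fixes M :: "nat multiset"
  assumes "\<forall>x\<in>#M. i \<le> x"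
  shows "i ^ size M \<le> \<Prod>\<^sub># M"
  using assms by (induction M) (auto intro: mult_mono)

text \<open>Induction, using x + y \<le> x y for x, y \<ge> 2.\<close>

lemma sum_mset_le_prod_mset:
  fixes M :: "nat multiset"
  assumes "\<forall>x\<in>#M. 2 \<le> x"
  shows "\<Sum>\<^sub># M \<le> \<Prod>\<^sub># M"
  using assms
proof (induction M)
  case (add x M)
  show ?case
  \<comment> \<open>The empty rest is separate because its product is 1, below the 2 that the
    inequality requires.\<close>
  proof (cases "M = {#}")
    case False
    then obtain y N where M: "M = add_mset y N"
      by (meson multiset_cases)
    have "\<forall>x\<in>#N. 1 \<le> x"
      using add.prems M by auto
    then have "1 \<le> \<Prod>\<^sub># N"
      using power_size_le_prod_mset[of N 1] by simp
    then have "2 \<le> \<Prod>\<^sub># M"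
      using add.prems M mult_le_mono[of 2 y 1 "\<Prod>\<^sub># N"] by simp
    \<comment> \<open>With both factors written as 2 plus a natural number, the inequality expands
      to 4 + a + b \<le> 4 + 2a + 2b + ab.\<close>
    then obtain a where a: "\<Prod>\<^sub># M = 2 + a"
      using le_Suc_ex by blast
    obtain b where b: "x = 2 + b"
      using add.prems le_Suc_ex[of 2 x] by auto
    have "x + \<Prod>\<^sub># M \<le> x * \<Prod>\<^sub># M"
      unfolding a b by (simp add: algebra_simps)
    then show ?thesis
      using add by simp
  qed simp
qed simp

section \<open>Recursion on the least element\<close>

lemma bounded_prod_msets_0:
  "bounded_prod_msets n 0 P i = (if P \<le> n then {{#}} else {})"
  by (auto simp: bounded_prod_msets_def)

text \<open>Here \<open>j\<close> is the least element. The bound on \<open>j\<close> follows from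
  membership, since all \<open>Suc k\<close> elements are at least \<open>j\<close>; it is spelled
  out because it becomes the upper limit of a summation index.\<close>

lemma bounded_prod_msets_Suc:
  "bounded_prod_msets n (Suc k) P i =
     (\<Union>j\<in>{j. i \<le> j \<and> P * j ^ Suc k \<le> n}. add_mset j ` bounded_prod_msets n k (P * j) j)"
  (is "?L = ?R")
proof (intro equalityI subsetI)
  fix M assume M: "M \<in> ?L"
  define j where "j = Min_mset M"
  have "M \<noteq> {#}"
    using M by (auto simp: bounded_prod_msets_def)
  then have j: "j \<in># M" "\<forall>x\<in>#M. j \<le> x"
    by (auto simp: j_def)
  then obtain N where N: "M = add_mset j N"
    by (metis insert_DiffM)
  have "P * j ^ Suc k \<le> P * \<Prod>\<^sub># M"
    using power_size_le_prod_mset[OF j(2)] M by (intro mult_left_mono) (auto simp: bounded_prod_msets_def)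
  also have "\<dots> \<le> n"
    using M by (simp add: bounded_prod_msets_def)
  finally have "P * j ^ Suc k \<le> n" .
  moreover have "N \<in> bounded_prod_msets n k (P * j) j" "i \<le> j"
    using M N j by (auto simp: bounded_prod_msets_def mult.assoc)
  ultimately show "M \<in> ?R"
    using N by blast
next
  fix M assume "M \<in> ?R"
  then show "M \<in> ?L"
    by (force simp: bounded_prod_msets_def mult.assoc)
qed

lemma finite_bounded_power:
  fixes P :: nat
  assumes "0 < P"
  shows "finite {j. i \<le> j \<and> P * j ^ Suc k \<le> n}"
proof (rule finite_subset)
  show "{j. i \<le> j \<and> P * j ^ Suc k \<le> n} \<subseteq> {..n}"
  proof
    fix j assume "j \<in> {j. i \<le> j \<and> P * j ^ Suc k \<le> n}"
    then have le: "P * j ^ Suc k \<le> n" by simp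
    have "j \<le> j ^ Suc k"
      by (cases "j = 0") simp_all
    also have "\<dots> \<le> P * j ^ Suc k"
      using assms by simp
    also have "\<dots> \<le> n"
      by (rule le)
    finally show "j \<in> {..n}"
      by simp
  qed
qed simp

lemma finite_bounded_prod_msets:
  assumes "0 < P" "0 < i"
  shows "finite (bounded_prod_msets n k P i)"
  using assms
proof (induction k arbitrary: P i)
  case (Suc k)
  then show ?case
    unfolding bounded_prod_msets_Suc
    by (intro finite_UN_I finite_bounded_power finite_imageI Suc.IH) auto
qed (simp add: bounded_prod_msets_0)

lemma card_bounded_prod_msets_Suc:
  assumes "0 < P" "0 < i"
  shows "card (bounded_prod_msets n (Suc k) P i) =
    (\<Sum>j | i \<le> j \<and> P * j ^ Suc k \<le> n. card (bounded_prod_msets n k (P * j) j))"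
proof -
  let ?A = "\<lambda>j. add_mset j ` bounded_prod_msets n k (P * j) j"
  \<comment> \<open>The minimum recovers \<open>j\<close>, so the sets of the union are
    disjoint.\<close>
  have least: "Min_mset M = j" if "M \<in> ?A j" for M j
    using that by (auto simp: bounded_prod_msets_def intro!: Min_eqI)
  have "card (bounded_prod_msets n (Suc k) P i) = (\<Sum>j | i \<le> j \<and> P * j ^ Suc k \<le> n. card (?A j))"
    unfolding bounded_prod_msets_Suc
  proof (intro card_UN_disjoint ballI impI)
    show "finite {j. i \<le> j \<and> P * j ^ Suc k \<le> n}"
      using assms by (intro finite_bounded_power)
    show "finite (?A j)" if "j \<in> {j. i \<le> j \<and> P * j ^ Suc k \<le> n}" for j
      using that assms by (intro finite_imageI finite_bounded_prod_msets) auto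
    show "?A j \<inter> ?A j' = {}" if "j \<noteq> j'" for j j'
      using that by (metis disjoint_iff least)
  qed
  also have "\<dots> = (\<Sum>j | i \<le> j \<and> P * j ^ Suc k \<le> n. card (bounded_prod_msets n k (P * j) j))"
    by (intro sum.cong refl card_image) (simp add: inj_on_def)
  finally show ?thesis .
qed

section \<open>Nested sums as cardinalities\<close>

text \<open>Raising to the power \<open>Suc k\<close> is monotone on nonnegative reals, so the real
  upper limit of an index becomes a condition on natural numbers.\<close>

lemma le_floor_root_iff:
  assumes "0 < P"
  shows "int j \<le> \<lfloor>root (Suc k) (real n / real P)\<rfloor> \<longleftrightarrow> P * j ^ Suc k \<le> n"
proof -
  have "int j \<le> \<lfloor>root (Suc k) (real n / real P)\<rfloor> \<longleftrightarrow> real j \<le> root (Suc k) (real n / real P)"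
    by (simp add: le_floor_iff)
  also have "\<dots> \<longleftrightarrow> root (Suc k) (real j ^ Suc k) \<le> root (Suc k) (real n / real P)"
    by (subst real_root_power_cancel) simp_all
  also have "\<dots> \<longleftrightarrow> real j ^ Suc k \<le> real n / real P"
    by (subst real_root_le_iff) simp_all
  also have "\<dots> \<longleftrightarrow> real (P * j ^ Suc k) \<le> real n"
    using assms by (simp add: pos_le_divide_eq mult.commute)
  finally show ?thesis
    by (simp only: of_nat_le_iff)
qed

text \<open>
  The last hypothesis keeps the innermost term \<open>\<lfloor>n / P\<rfloor> - i + 1\<close> from becoming negative.
\<close>

lemma nested_sum_eq_card:
  assumes "0 < P" "0 < i" "P * i ^ Suc m \<le> n"
  shows "nested_sum n m (int P) (int i) = int (card (bounded_prod_msets n (Suc m) P i))"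
  using assms
proof (induction m arbitrary: P i)
  case 0
  have "card (bounded_prod_msets n (Suc 0) P i) = (\<Sum>j | i \<le> j \<and> P * j \<le> n. 1)"
    using 0 by (subst card_bounded_prod_msets_Suc) (auto simp: bounded_prod_msets_0 intro!: sum.cong)
  also have "{j. i \<le> j \<and> P * j \<le> n} = {i..n div P}"
    using 0 by (auto simp: less_eq_div_iff_mult_less_eq mult.commute)
  also have "(\<Sum>j\<in>{i..n div P}. 1) = Suc (n div P) - i"
    by simp
  finally have "card (bounded_prod_msets n (Suc 0) P i) = Suc (n div P) - i" .
  \<comment> \<open>This makes the natural-number subtraction agree with the integer one in
    \<open>nested_sum\<close>.\<close>
  moreover have "i \<le> n div P"
    using 0 by (simp add: less_eq_div_iff_mult_less_eq mult.commute)
  ultimately show ?case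
    by (simp add: floor_divide_of_nat_eq)
next
  case (Suc m)
  let ?J = "{j. i \<le> j \<and> P * j ^ Suc (Suc m) \<le> n}"
  let ?r = "\<lfloor>root (Suc (Suc m)) (real n / real P)\<rfloor>"
  have range: "{int i..?r} = int ` ?J"
  proof (intro equalityI subsetI)
    fix x assume x: "x \<in> {int i..?r}"
    then obtain j where "x = int j"
      using zero_le_imp_eq_int[of x] by fastforce
    then show "x \<in> int ` ?J"
      using x le_floor_root_iff[OF Suc.prems(1), of j "Suc m" n] by auto
  next
    fix x assume "x \<in> int ` ?J"
    then obtain j where j: "x = int j" "i \<le> j" "P * j ^ Suc (Suc m) \<le> n"
      by blast
    then show "x \<in> {int i..?r}"
      using le_floor_root_iff[OF Suc.prems(1), of j "Suc m" n] by auto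
  qed
  have "nested_sum n (Suc m) (int P) (int i) = (\<Sum>x\<in>{int i..?r}. nested_sum n m (int P * x) x)"
    by simp
  also have "\<dots> = (\<Sum>j\<in>?J. nested_sum n m (int (P * j)) (int j))"
    unfolding range by (subst sum.reindex) simp_all
  also have "\<dots> = (\<Sum>j\<in>?J. int (card (bounded_prod_msets n (Suc m) (P * j) j)))"
    \<comment> \<open>For \<open>j\<close> in \<open>?J\<close>, the condition
      \<open>P * j ^ Suc (Suc m) \<le> n\<close> is the last hypothesis of the induction step for
      \<open>P * j\<close> and \<open>j\<close>.\<close>
    using Suc.prems by (intro sum.cong refl Suc.IH) (auto simp: mult.assoc)
  also have "\<dots> = int (card (bounded_prod_msets n (Suc (Suc m)) P i))"
    using Suc.prems by (subst card_bounded_prod_msets_Suc) simp_all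
  finally show ?case .
qed

section \<open>Removing the parts equal to 1\<close>

lemma filter_mset_ge_2_plus_ones:
  fixes M :: "nat multiset"
  assumes "\<forall>x\<in>#M. 0 < x"
  shows "M = filter_mset ((\<le>) 2) M + replicate_mset (count M 1) 1"
proof (rule multiset_eqI)
  fix x :: nat
  have "count M 0 = 0"
    using assms by (auto simp: count_eq_zero_iff)
  consider "x = 0" | "x = 1" | "2 \<le> x"
    by linarith
  then show "count M x = count (filter_mset ((\<le>) 2) M + replicate_mset (count M 1) 1) x"
    by cases (simp_all add: \<open>count M 0 = 0\<close>)
qed

text \<open>Padding with ones is a bijection onto the partitions counted. The hypothesis
  \<open>m \<le> n\<close> leaves room for it: the sum is at most the product, hence at most
  \<open>n\<close>.\<close>

lemma num_partitions_prod_le_eq_card: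
  assumes "m \<le> n"
  shows "num_partitions_prod_le m n = card {M. (\<forall>x\<in>#M. 2 \<le> x) \<and> \<Prod>\<^sub># M \<le> m}"
proof -
  let ?T = "{M. (\<forall>x\<in>#M. 2 \<le> x) \<and> \<Prod>\<^sub># M \<le> m}"
  let ?f = "\<lambda>M. M + replicate_mset (n - \<Sum>\<^sub># M) (1::nat)"
  \<comment> \<open>Filtering is a left inverse of padding, which gives injectivity below.\<close>
  have ge2: "filter_mset ((\<le>) 2) (?f M) = M" if "M \<in> ?T" for M
  proof -
    have "filter_mset ((\<le>) 2) M = M"
      using that by (simp add: filter_mset_eq_conv)
    moreover have "filter_mset ((\<le>) 2) (replicate_mset k (1::nat)) = {#}" for k
      by (induction k) simp_all
    ultimately show ?thesis
      by simp
  qed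
  have "{M \<in> partitions n. \<Prod>\<^sub># M \<le> m} = ?f ` ?T"
  proof (intro equalityI subsetI)
    fix M assume M: "M \<in> {M \<in> partitions n. \<Prod>\<^sub># M \<le> m}"
    define N where "N = filter_mset ((\<le>) 2) M"
    have eq: "M = N + replicate_mset (count M 1) 1"
      unfolding N_def using M by (intro filter_mset_ge_2_plus_ones) (auto simp: partitions_def)
    have "\<Sum>\<^sub># M = \<Sum>\<^sub># N + count M 1" "\<Prod>\<^sub># M = \<Prod>\<^sub># N"
      by (subst eq, simp)+
    with M have "N \<in> ?T" "count M 1 = n - \<Sum>\<^sub># N"
      by (auto simp: N_def partitions_def)
    with eq show "M \<in> ?f ` ?T"
      by auto
  next
    fix M assume "M \<in> ?f ` ?T"
    then obtain N where N: "M = ?f N" "\<forall>x\<in>#N. 2 \<le> x" "\<Prod>\<^sub># N \<le> m"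
      by blast
    then have "\<Sum>\<^sub># N \<le> n"
      using sum_mset_le_prod_mset[of N] assms by linarith
    then show "M \<in> {M \<in> partitions n. \<Prod>\<^sub># M \<le> m}"
      using N by (auto simp: partitions_def)
  qed
  moreover have "inj_on ?f ?T"
    by (rule inj_on_inverseI[where g = "filter_mset ((\<le>) 2)"]) (rule ge2)
  ultimately show ?thesis
    by (simp add: num_partitions_prod_le_def card_image)
qed

theorem theorem1:
  fixes n l :: nat
  assumes "n > 0" and "2 ^ l \<le> n" and "n < 2 ^ (l + 1)"
  shows "int (num_partitions_prod_le n n) = int n + (\<Sum>k = 2..l. nested_sum n (k - 1) 1 2)"
proof -
  let ?A = "\<lambda>k. bounded_prod_msets n k 1 2"
  \<comment> \<open>Classification by size; a size above \<open>l\<close> would force a product of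
    at least \<open>2 ^ (l + 1)\<close>, which exceeds \<open>n\<close>.\<close>
  have "{M. (\<forall>x\<in>#M. 2 \<le> x) \<and> \<Prod>\<^sub># M \<le> n} = (\<Union>k\<in>{0..l}. ?A k)"
  proof (intro equalityI subsetI)
    fix M assume M: "M \<in> {M. (\<forall>x\<in>#M. 2 \<le> x) \<and> \<Prod>\<^sub># M \<le> n}"
    then have "2 ^ size M \<le> \<Prod>\<^sub># M"
      by (intro power_size_le_prod_mset) simp
    then have "(2::nat) ^ size M < 2 ^ (l + 1)"
      using M assms(3) by simp
    then have "size M < l + 1"
      by (rule power_less_imp_less_exp[rotated]) simp
    then show "M \<in> (\<Union>k\<in>{0..l}. ?A k)"
      using M by (simp add: bounded_prod_msets_def)
  qed (auto simp: bounded_prod_msets_def)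
  then have "num_partitions_prod_le n n = card (\<Union>k\<in>{0..l}. ?A k)"
    by (simp add: num_partitions_prod_le_eq_card)
  also have "\<dots> = (\<Sum>k = 0..l. card (?A k))"
    by (intro card_UN_disjoint)
       (simp_all add: finite_bounded_prod_msets, auto simp: bounded_prod_msets_def)
  finally have total: "int (num_partitions_prod_le n n) = (\<Sum>k = 0..l. int (card (?A k)))"
    by simp
  have empty: "int (card (?A 0)) = 1"
    using assms(1) by (simp add: bounded_prod_msets_0)
  \<comment> \<open>Since \<open>k \<le> l\<close>, the condition \<open>2 ^ k \<le> n\<close>
    holds, as \<open>nested_sum_eq_card\<close> demands for \<open>P = 1\<close> and
    \<open>i = 2\<close>.\<close>
  have card_eq: "int (card (?A k)) = nested_sum n (k - 1) 1 2" if "1 \<le> k" "k \<le> l" for k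
  proof -
    have "(2::nat) ^ k \<le> 2 ^ l"
      using that by simp
    with assms(2) have "2 ^ k \<le> n"
      by (rule order_trans[rotated])
    then show ?thesis
      using that nested_sum_eq_card[of 1 2 "k - 1" n] by simp
  qed
  show ?thesis
  \<comment> \<open>If \<open>l = 0\<close> then \<open>n = 1\<close>, and the empty multiset alone
    is counted; otherwise size 1 occurs and is split off as well.\<close>
  proof (cases "l = 0")
    case True
    then show ?thesis
      using total empty assms by simp
  next
    case False
    then have "(\<Sum>k = 0..l. int (card (?A k)))
      = int (card (?A 0)) + (int (card (?A 1)) + (\<Sum>k = 2..l. int (card (?A k))))"
      by (simp add: sum.atLeast_Suc_atMost numeral_2_eq_2)
    also have "int (card (?A 1)) = int n - 1"
      \<comment> \<open>The singletons contribute n - 2 + 1; with the empty multiset this makes the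
        leading term \<open>n\<close>.\<close>
      using card_eq[of 1] False by simp
    also have "(\<Sum>k = 2..l. int (card (?A k))) = (\<Sum>k = 2..l. nested_sum n (k - 1) 1 2)"
      by (intro sum.cong refl card_eq) auto
    finally show ?thesis
      using total empty by simp
  qed
qed

end
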